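(* Let $\mathbb{F}$ be a field, $G$ a finite group and $n\ge 1$. The assignment $$g\mapsto g,\quad s_i\mapsto (i,i+1),\quad \varepsilon_j\mapsto 0\qquad (g\in G^n,\ 1\le i\le n-1,\ 1\le j\le n)$$ defines an algebra homomorphism $\Phi:\mathbb{F}\overline{G}_n\to\mathbb{F}G_n$, which is an extension of the identity map of the subalgebra $\mathbb{F}G_n$.
   Context: $\overline{G}_n$ is the semigroup of $n\times n$ matrices with entries in $G\cup\{0\}$ having at most one nonzero entry in each row and column, under matrix multiplication with $g0=0g=0$, $g+0=0+g=g$ (0 an extra symbol). $G_n\subseteq\overline{G}_n$ is the subgroup of matrices with exactly one nonzero entry in each row and column (the wreath product of $G$ with $S_n$). $\mathbb{F}\overline{G}_n$ is the semigroup algebra with basis $\overline{G}_n$ (the zero matrix is one of the basis elements). A permutation $\sigma\in S_n$ is identified with the matrix having $1$ in position $(i,j)$ iff $\sigma(j)=i$, and $g=(g_1,\dots,g_n)\in G^n$ with the diagonal matrix with entries $g_i$; $s_i=(i,i+1)$; $\varepsilon_j$ is the diagonal matrix with $(j,j)$ entry $0$ and other diagonal entries $1$. The semigroup $\overline{G}_n$ is generated by $G_n$ and $\varepsilon_1,\dots,\varepsilon_n$. *)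

theory Defs
  imports "HOL-Algebra.Module" "HOL-Combinatorics.Transposition" "Jordan_Normal_Form.Matrix"
begin

text \<open>The set \<open>G \<union> {0}\<close> is the option type, with \<open>None\<close> as the extra symbol \<open>0\<close>.
  A sum of two elements of \<open>G\<close> is meaningless; it never occurs when multiplying
  matrices with at most one nonzero entry in each row and column.\<close>

fun zero_add :: "'g option \<Rightarrow> 'g option \<Rightarrow> 'g option" where
  "zero_add None y = y"
| "zero_add (Some g) None = Some g"
| "zero_add (Some g) (Some h) = undefined"

fun zero_mult :: "('g, 'm) monoid_scheme \<Rightarrow> 'g option \<Rightarrow> 'g option \<Rightarrow> 'g option" where
  "zero_mult G (Some g) (Some h) = Some (g \<otimes>\<^bsub>G\<^esub> h)"
| "zero_mult G None y = None"
| "zero_mult G x None = None"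

text \<open>Rows and columns are numbered \<open>0, \<dots>, n - 1\<close>, as usual for the type \<open>mat\<close>.\<close>

definition zero_mat_mult ::
  "('g, 'm) monoid_scheme \<Rightarrow> nat \<Rightarrow> 'g option mat \<Rightarrow> 'g option mat \<Rightarrow> 'g option mat" where
  "zero_mat_mult G n A B = mat n n (\<lambda>(i, j).
     foldr zero_add (map (\<lambda>k. zero_mult G (A $$ (i, k)) (B $$ (k, j))) [0..<n]) None)"

definition diag_matrix :: "nat \<Rightarrow> (nat \<Rightarrow> 'g option) \<Rightarrow> 'g option mat" where
  "diag_matrix n d = mat n n (\<lambda>(i, j). if i = j then d i else None)"

definition perm_matrix :: "('g, 'm) monoid_scheme \<Rightarrow> nat \<Rightarrow> (nat \<Rightarrow> nat) \<Rightarrow> 'g option mat" where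
  "perm_matrix G n \<sigma> = mat n n (\<lambda>(i, j). if \<sigma> j = i then Some \<one>\<^bsub>G\<^esub> else None)"

definition group_tuple :: "nat \<Rightarrow> (nat \<Rightarrow> 'g) \<Rightarrow> 'g option mat" where
  "group_tuple n g = diag_matrix n (\<lambda>i. Some (g i))"

definition simple_transp :: "('g, 'm) monoid_scheme \<Rightarrow> nat \<Rightarrow> nat \<Rightarrow> 'g option mat" where
  "simple_transp G n i = perm_matrix G n (Transposition.transpose i (Suc i))"

definition eps :: "('g, 'm) monoid_scheme \<Rightarrow> nat \<Rightarrow> nat \<Rightarrow> 'g option mat" where
  "eps G n j = diag_matrix n (\<lambda>i. if i = j then None else Some \<one>\<^bsub>G\<^esub>)"

definition Gbar :: "('g, 'm) monoid_scheme \<Rightarrow> nat \<Rightarrow> 'g option mat monoid" where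
  "Gbar G n =
    \<lparr> carrier = {A \<in> carrier_mat n n.
        (\<forall>i<n. \<forall>j<n. A $$ (i, j) \<in> insert None (Some ` carrier G)) \<and>
        (\<forall>i<n. \<exists>\<^sub>\<le>\<^sub>1 j. j < n \<and> A $$ (i, j) \<noteq> None) \<and>
        (\<forall>j<n. \<exists>\<^sub>\<le>\<^sub>1 i. i < n \<and> A $$ (i, j) \<noteq> None)},
      mult = zero_mat_mult G n,
      one = diag_matrix n (\<lambda>i. Some \<one>\<^bsub>G\<^esub>) \<rparr>"

definition Gwr :: "('g, 'm) monoid_scheme \<Rightarrow> nat \<Rightarrow> 'g option mat monoid" where
  "Gwr G n = (Gbar G n)
    \<lparr> carrier := {A \<in> carrier_mat n n.
        (\<forall>i<n. \<forall>j<n. A $$ (i, j) \<in> insert None (Some ` carrier G)) \<and>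
        (\<forall>i<n. \<exists>! j. j < n \<and> A $$ (i, j) \<noteq> None) \<and>
        (\<forall>j<n. \<exists>! i. i < n \<and> A $$ (i, j) \<noteq> None)} \<rparr>"

definition basis_elem :: "('f, 'x) ring_scheme \<Rightarrow> 's \<Rightarrow> 's \<Rightarrow> 'f" where
  "basis_elem F s = (\<lambda>t. if t = s then \<one>\<^bsub>F\<^esub> else \<zero>\<^bsub>F\<^esub>)"

text \<open>Elements of the algebra are the finitely supported coefficient functions vanishing
  outside \<open>carrier S\<close>, so the algebra of a submonoid is literally a subset of the algebra
  of the monoid. A zero element of \<open>S\<close> is a basis element like any other.\<close>

definition monoid_algebra ::
  "('f, 'x) ring_scheme \<Rightarrow> ('s, 'y) monoid_scheme \<Rightarrow> ('f, 's \<Rightarrow> 'f) module" where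
  "monoid_algebra F S =
    \<lparr> carrier = {a. range a \<subseteq> carrier F \<and> finite {s. a s \<noteq> \<zero>\<^bsub>F\<^esub>} \<and>
        {s. a s \<noteq> \<zero>\<^bsub>F\<^esub>} \<subseteq> carrier S},
      mult = (\<lambda>a b u. \<Oplus>\<^bsub>F\<^esub>p \<in> {(s, t). a s \<noteq> \<zero>\<^bsub>F\<^esub> \<and> b t \<noteq> \<zero>\<^bsub>F\<^esub> \<and> s \<otimes>\<^bsub>S\<^esub> t = u}.
        a (fst p) \<otimes>\<^bsub>F\<^esub> b (snd p)),
      one = basis_elem F \<one>\<^bsub>S\<^esub>,
      zero = (\<lambda>s. \<zero>\<^bsub>F\<^esub>),
      add = (\<lambda>a b s. a s \<oplus>\<^bsub>F\<^esub> b s),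
      smult = (\<lambda>c a s. c \<otimes>\<^bsub>F\<^esub> a s) \<rparr>"

text \<open>The library locale \<open>algebra\<close> only covers commutative algebras.\<close>

definition algebra_hom ::
  "('f, 'x) ring_scheme \<Rightarrow> ('f, 'a, 'y) module_scheme \<Rightarrow> ('f, 'b, 'z) module_scheme
    \<Rightarrow> ('a \<Rightarrow> 'b) set" where
  "algebra_hom F A B = {h \<in> ring_hom A B.
     \<forall>c \<in> carrier F. \<forall>x \<in> carrier A. h (c \<odot>\<^bsub>A\<^esub> x) = c \<odot>\<^bsub>B\<^esub> h x}"

definition generator_assignment ::
  "('f, 'x) ring_scheme \<Rightarrow> ('g, 'm) monoid_scheme \<Rightarrow> nat
    \<Rightarrow> (('g option mat \<Rightarrow> 'f) \<Rightarrow> ('g option mat \<Rightarrow> 'f)) \<Rightarrow> bool" where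
  "generator_assignment F G n \<Phi> \<longleftrightarrow>
     (\<forall>g \<in> {..<n} \<rightarrow> carrier G.
        \<Phi> (basis_elem F (group_tuple n g)) = basis_elem F (group_tuple n g)) \<and>
     (\<forall>i. Suc i < n \<longrightarrow>
        \<Phi> (basis_elem F (simple_transp G n i)) = basis_elem F (simple_transp G n i)) \<and>
     (\<forall>j<n. \<Phi> (basis_elem F (eps G n j)) = \<zero>\<^bsub>monoid_algebra F (Gwr G n)\<^esub>)"

end

theory Submission
  imports Defs "HOL-Combinatorics.Permutations"
begin

text \<open>
  \<open>\<Phi>\<close> forgets the coefficients outside \<open>G\<^sub>n\<close>. It is multiplicative because the singular
  matrices form an ideal: a product of two elements of the semigroup has no zero row and no zero
  column iff the same holds for both factors. For uniqueness, a singular matrix \<open>A\<close> has a zero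
  row \<open>j\<close> and satisfies \<open>A = \<epsilon>\<^sub>j A\<close>, so every admissible homomorphism kills it, while \<open>G\<^sub>n\<close> is generated by the diagonal matrices and the adjacent transpositions.
\<close>

section \<open>Monoid algebras\<close>

context field
begin

lemma basis_elem_in_carrier:
  assumes "s \<in> carrier S"
  shows "basis_elem R s \<in> carrier (monoid_algebra R S)"
proof -
  have "{t. basis_elem R s t \<noteq> \<zero>} = {s}"
    by (auto simp: basis_elem_def)
  with assms show ?thesis
    by (auto simp: monoid_algebra_def basis_elem_def)
qed

text \<open>Since \<open>\<one> \<noteq> \<zero>\<close> in a field, both supports are singletons
  and the convolution sum has at most one term.\<close>

lemma basis_elem_mult:
  "basis_elem R s \<otimes>\<^bsub>monoid_algebra R S\<^esub> basis_elem R t = basis_elem R (s \<otimes>\<^bsub>S\<^esub> t)"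
proof
  fix u
  have supp: "{(s', t'). basis_elem R s s' \<noteq> \<zero> \<and> basis_elem R t t' \<noteq> \<zero> \<and> s' \<otimes>\<^bsub>S\<^esub> t' = u}
      = (if s \<otimes>\<^bsub>S\<^esub> t = u then {(s, t)} else {})"
    by (auto simp: basis_elem_def)
  show "(basis_elem R s \<otimes>\<^bsub>monoid_algebra R S\<^esub> basis_elem R t) u = basis_elem R (s \<otimes>\<^bsub>S\<^esub> t) u"
    by (simp add: monoid_algebra_def supp) (auto simp: basis_elem_def)
qed

lemma monoid_algebra_zero_mult:
  "\<zero>\<^bsub>monoid_algebra R S\<^esub> \<otimes>\<^bsub>monoid_algebra R S\<^esub> a = \<zero>\<^bsub>monoid_algebra R S\<^esub>"
  by (simp add: monoid_algebra_def)

text \<open>Additivity alone would require cancellation in the target. Homogeneity is more direct: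
  zero is the scalar \<open>\<zero>\<close> times itself, and scaling any element of the target by
  \<open>\<zero>\<close> gives zero.\<close>

lemma algebra_hom_zero:
  assumes h: "h \<in> algebra_hom R (monoid_algebra R S) (monoid_algebra R T)"
  shows "h \<zero>\<^bsub>monoid_algebra R S\<^esub> = \<zero>\<^bsub>monoid_algebra R T\<^esub>"
proof -
  let ?z = "\<zero>\<^bsub>monoid_algebra R S\<^esub>"
  have z: "?z \<in> carrier (monoid_algebra R S)"
    by (auto simp: monoid_algebra_def)
  have zz: "\<zero> \<odot>\<^bsub>monoid_algebra R S\<^esub> ?z = ?z"
    by (simp add: monoid_algebra_def)
  have "h ?z \<in> carrier (monoid_algebra R T)"
    using h z by (auto simp: algebra_hom_def ring_hom_def)
  then have "\<zero> \<odot>\<^bsub>monoid_algebra R T\<^esub> h ?z = \<zero>\<^bsub>monoid_algebra R T\<^esub>"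
    by (auto simp: monoid_algebra_def image_subset_iff)
  moreover have "h (\<zero> \<odot>\<^bsub>monoid_algebra R S\<^esub> ?z) = \<zero> \<odot>\<^bsub>monoid_algebra R T\<^esub> h ?z"
    using h z unfolding algebra_hom_def by blast
  ultimately show ?thesis
    by (simp add: zz)
qed

text \<open>The basis elements span: induction on the finite support splits off one term at a time,
  and linearity carries the agreement over.\<close>

lemma algebra_hom_eqI:
  assumes h: "h \<in> algebra_hom R (monoid_algebra R S) (monoid_algebra R T)"
    and k: "k \<in> algebra_hom R (monoid_algebra R S) (monoid_algebra R T)"
    and eq: "\<And>s. s \<in> carrier S \<Longrightarrow> h (basis_elem R s) = k (basis_elem R s)"
    and a: "a \<in> carrier (monoid_algebra R S)"
  shows "h a = k a"
proof -
  let ?A = "monoid_algebra R S" and ?B = "monoid_algebra R T"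
  have "h a = k a" if "finite X" "a \<in> carrier ?A" "{s. a s \<noteq> \<zero>} = X" for X a
    using that
  proof (induction X arbitrary: a rule: finite_induct)
    case empty
    then have "a = \<zero>\<^bsub>?A\<^esub>"
      by (auto simp: monoid_algebra_def)
    then show ?case
      using algebra_hom_zero[OF h] algebra_hom_zero[OF k] by simp
  next
    case (insert s X)
    \<comment> \<open>Deleting the coefficient at \<open>s\<close> leaves support \<open>X\<close>,
      so the induction hypothesis applies to \<open>b\<close>, and \<open>a\<close> is its
      \<open>s\<close>-term plus \<open>b\<close>.\<close>
    define b where "b = a(s := \<zero>)"
    have rng: "a t \<in> carrier R" for t
      using insert.prems by (auto simp: monoid_algebra_def)
    have s: "s \<in> carrier S"
      using insert.prems by (auto simp: monoid_algebra_def)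
    have suppb: "{t. b t \<noteq> \<zero>} = X"
      using insert.prems insert.hyps by (auto simp: b_def)
    have b: "b \<in> carrier ?A"
      using suppb insert.hyps insert.prems rng by (auto simp: monoid_algebra_def b_def)
    have e: "basis_elem R s \<in> carrier ?A"
      using s by (rule basis_elem_in_carrier)
    let ?c = "a s \<odot>\<^bsub>?A\<^esub> basis_elem R s"
    have c_supp: "{t. ?c t \<noteq> \<zero>} \<subseteq> {s}"
      using rng by (auto simp: monoid_algebra_def basis_elem_def)
    then have "finite {t. ?c t \<noteq> \<zero>}" "{t. ?c t \<noteq> \<zero>} \<subseteq> carrier S"
      using s by (auto intro: finite_subset)
    then have c: "?c \<in> carrier ?A"
      using rng by (auto simp: monoid_algebra_def basis_elem_def)
    have a: "a = ?c \<oplus>\<^bsub>?A\<^esub> b"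
      using rng by (auto simp: monoid_algebra_def basis_elem_def b_def)
    \<comment> \<open>Stated for an arbitrary homomorphism so that it serves both \<open>h\<close>
      and \<open>k\<close>.\<close>
    have "f a = (a s \<odot>\<^bsub>?B\<^esub> f (basis_elem R s)) \<oplus>\<^bsub>?B\<^esub> f b" if "f \<in> algebra_hom R ?A ?B" for f
    proof -
      have "f (?c \<oplus>\<^bsub>?A\<^esub> b) = f ?c \<oplus>\<^bsub>?B\<^esub> f b"
        using that b c by (auto simp: algebra_hom_def ring_hom_def)
      moreover have "f ?c = a s \<odot>\<^bsub>?B\<^esub> f (basis_elem R s)"
        using that rng e by (auto simp: algebra_hom_def)
      ultimately show ?thesis
        using a by metis
    qed
    from this[OF h] this[OF k] show ?case
      using eq[OF s] insert.IH[OF b suppb] by simp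
  qed
  moreover have "finite {s. a s \<noteq> \<zero>}"
    using a by (simp add: monoid_algebra_def)
  ultimately show ?thesis
    using a by blast
qed

text \<open>The linear projection onto the span of \<open>U\<close> along the span of its
  complement. With \<open>U\<close> the carrier of \<open>Gwr G n\<close> it becomes \<Phi>.\<close>

definition restrict_coeffs :: "'s set \<Rightarrow> ('s \<Rightarrow> 'a) \<Rightarrow> 's \<Rightarrow> 'a" where
  "restrict_coeffs U a = (\<lambda>s. if s \<in> U then a s else \<zero>)"

lemma restrict_coeffs_basis_elem:
  "restrict_coeffs U (basis_elem R s) = (if s \<in> U then basis_elem R s else (\<lambda>_. \<zero>))"
  by (auto simp: restrict_coeffs_def basis_elem_def)

lemma restrict_coeffs_id:
  assumes "a \<in> carrier (monoid_algebra R T)"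
  shows "restrict_coeffs (carrier T) a = a"
proof -
  have "a s = \<zero>" if "s \<notin> carrier T" for s
    using assms that by (auto simp: monoid_algebra_def)
  then show ?thesis
    by (auto simp: restrict_coeffs_def fun_eq_iff)
qed

text \<open>The hypothesis on products says that \<open>T\<close> is a submonoid whose complement is an ideal.\<close>

lemma restrict_coeffs_algebra_hom:
  assumes one: "\<one>\<^bsub>T\<^esub> = \<one>\<^bsub>S\<^esub>" "\<one>\<^bsub>T\<^esub> \<in> carrier T"
    and mult: "\<And>s t. s \<otimes>\<^bsub>T\<^esub> t = s \<otimes>\<^bsub>S\<^esub> t"
    and prime: "\<And>s t. s \<in> carrier S \<Longrightarrow> t \<in> carrier S \<Longrightarrow>
      s \<otimes>\<^bsub>S\<^esub> t \<in> carrier T \<longleftrightarrow> s \<in> carrier T \<and> t \<in> carrier T"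
  shows "restrict_coeffs (carrier T) \<in> algebra_hom R (monoid_algebra R S) (monoid_algebra R T)"
proof -
  let ?A = "monoid_algebra R S" and ?B = "monoid_algebra R T"
  let ?r = "restrict_coeffs (carrier T)"
  have "?r a \<in> carrier ?B" if "a \<in> carrier ?A" for a
  proof -
    have "{s. ?r a s \<noteq> \<zero>} \<subseteq> {s. a s \<noteq> \<zero>}"
      by (auto simp: restrict_coeffs_def)
    then have "finite {s. ?r a s \<noteq> \<zero>}"
      using that by (auto simp: monoid_algebra_def intro: finite_subset)
    then show ?thesis
      using that by (auto simp: monoid_algebra_def restrict_coeffs_def)
  qed
  moreover have "?r (a \<otimes>\<^bsub>?A\<^esub> b) = ?r a \<otimes>\<^bsub>?B\<^esub> ?r b" if "a \<in> carrier ?A" "b \<in> carrier ?A" for a b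
  proof
    fix u
    have rng: "a s \<in> carrier R" "b s \<in> carrier R" for s
      using that by (auto simp: monoid_algebra_def)
    have supp: "s \<in> carrier S" if "a s \<noteq> \<zero> \<or> b s \<noteq> \<zero>" for s
      using that \<open>a \<in> carrier ?A\<close> \<open>b \<in> carrier ?A\<close> by (auto simp: monoid_algebra_def)
    let ?P = "{(s, t). a s \<noteq> \<zero> \<and> b t \<noteq> \<zero> \<and> s \<otimes>\<^bsub>S\<^esub> t = u}"
    let ?Q = "{(s, t). ?r a s \<noteq> \<zero> \<and> ?r b t \<noteq> \<zero> \<and> s \<otimes>\<^bsub>T\<^esub> t = u}"
    show "?r (a \<otimes>\<^bsub>?A\<^esub> b) u = (?r a \<otimes>\<^bsub>?B\<^esub> ?r b) u"
    proof (cases "u \<in> carrier T")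
      case True
      \<comment> \<open>Here the ideal property of the complement enters: a product in
        \<open>T\<close> has both factors in \<open>T\<close>, so the restriction loses no term of
        the sum.\<close>
      have PT: "s \<in> carrier T \<and> t \<in> carrier T" if "(s, t) \<in> ?P" for s t
        using that True supp prime by blast
      then have PQ: "?P = ?Q"
        by (auto simp: restrict_coeffs_def mult split: if_splits)
      have "(\<Oplus>p\<in>?P. a (fst p) \<otimes> b (snd p)) = (\<Oplus>p\<in>?Q. ?r a (fst p) \<otimes> ?r b (snd p))"
        using PQ PT rng by (intro finsum_cong') (auto simp: restrict_coeffs_def)
      then show ?thesis
        using True by (simp add: monoid_algebra_def restrict_coeffs_def)
    next
      case False
      \<comment> \<open>The other direction of \<open>prime\<close>: \<open>T\<close> is closed
        under products, so no pair surviving the restriction multiplies to \<open>u\<close>.\<close>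
      then have Q: "?Q = {}"
        using supp prime mult by (auto simp: restrict_coeffs_def split: if_splits)
      have "(?r a \<otimes>\<^bsub>?B\<^esub> ?r b) u = (\<Oplus>p\<in>?Q. ?r a (fst p) \<otimes> ?r b (snd p))"
        by (simp add: monoid_algebra_def)
      also have "\<dots> = \<zero>"
        unfolding Q by simp
      finally show ?thesis
        using False by (simp add: restrict_coeffs_def)
    qed
  qed
  moreover have "?r (a \<oplus>\<^bsub>?A\<^esub> b) = ?r a \<oplus>\<^bsub>?B\<^esub> ?r b" for a b
    by (auto simp: monoid_algebra_def restrict_coeffs_def)
  moreover have "?r \<one>\<^bsub>?A\<^esub> = \<one>\<^bsub>?B\<^esub>"
    using one by (simp add: monoid_algebra_def restrict_coeffs_basis_elem)
  moreover have "?r (c \<odot>\<^bsub>?A\<^esub> a) = c \<odot>\<^bsub>?B\<^esub> ?r a" if "c \<in> carrier R" for a c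
    using that by (auto simp: monoid_algebra_def restrict_coeffs_def)
  ultimately show ?thesis
    by (auto simp: algebra_hom_def ring_hom_def)
qed

end

section \<open>Monomial matrices\<close>

lemma zero_add_None_right [simp]: "zero_add x None = x"
  by (cases x) auto

lemma zero_mult_None_right [simp]: "zero_mult G x None = None"
  by (cases x) auto

lemma foldr_zero_add_None:
  assumes "\<And>k. k \<in> set ks \<Longrightarrow> f k = None"
  shows "foldr zero_add (map f ks) None = None"
  using assms by (induction ks) auto

text \<open>At most one summand differs from \<open>None\<close>, so the \<open>undefined\<close>
  clause of \<open>zero_add\<close> is never reached.\<close>

lemma foldr_zero_add_single:
  assumes "distinct ks" "k\<^sub>0 \<in> set ks" "\<And>k. k \<in> set ks \<Longrightarrow> k \<noteq> k\<^sub>0 \<Longrightarrow> f k = None"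
  shows "foldr zero_add (map f ks) None = f k\<^sub>0"
  using assms
proof (induction ks)
  case (Cons k ks)
  show ?case
  proof (cases "k = k\<^sub>0")
    case True
    have "foldr zero_add (map f ks) None = None"
      using Cons.prems True by (intro foldr_zero_add_None) auto
    then show ?thesis
      using True by simp
  next
    case False
    then show ?thesis
      using Cons by auto
  qed
qed simp

text \<open>Used in contrapositive form: a nonzero entry of a product yields an index
  \<open>k\<close> at which both factors are nonzero.\<close>

lemma zero_mat_mult_entry_None:
  assumes "i < n" "j < n" "\<And>k. k < n \<Longrightarrow> A $$ (i, k) = None \<or> B $$ (k, j) = None"
  shows "zero_mat_mult G n A B $$ (i, j) = None"
proof -
  have "foldr zero_add (map (\<lambda>k. zero_mult G (A $$ (i, k)) (B $$ (k, j))) [0..<n]) None = None"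
    by (rule foldr_zero_add_None) (use assms in force)
  then show ?thesis
    using assms by (simp add: zero_mat_mult_def)
qed

lemma zero_mat_mult_entry_single:
  assumes "i < n" "j < n" "k\<^sub>0 < n"
    "\<And>k. k < n \<Longrightarrow> k \<noteq> k\<^sub>0 \<Longrightarrow> A $$ (i, k) = None \<or> B $$ (k, j) = None"
  shows "zero_mat_mult G n A B $$ (i, j) = zero_mult G (A $$ (i, k\<^sub>0)) (B $$ (k\<^sub>0, j))"
proof -
  have "foldr zero_add (map (\<lambda>k. zero_mult G (A $$ (i, k)) (B $$ (k, j))) [0..<n]) None
      = zero_mult G (A $$ (i, k\<^sub>0)) (B $$ (k\<^sub>0, j))"
    by (rule foldr_zero_add_single) (use assms in force)+
  then show ?thesis
    using assms by (simp add: zero_mat_mult_def)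
qed

text \<open>The normal form of wreath product elements, a permutation matrix times a diagonal
  matrix. The diagonal factor stands on the right, hence \<open>g\<close> is indexed by
  columns.\<close>

definition monomial_mat :: "nat \<Rightarrow> (nat \<Rightarrow> nat) \<Rightarrow> (nat \<Rightarrow> 'g) \<Rightarrow> 'g option mat" where
  "monomial_mat n \<sigma> g = mat n n (\<lambda>(i, j). if \<sigma> j = i then Some (g j) else None)"

lemma perm_matrix_eq_monomial: "perm_matrix G n \<sigma> = monomial_mat n \<sigma> (\<lambda>_. \<one>\<^bsub>G\<^esub>)"
  by (simp add: perm_matrix_def monomial_mat_def)

lemma group_tuple_eq_monomial: "group_tuple n g = monomial_mat n id g"
  by (auto simp: group_tuple_def diag_matrix_def monomial_mat_def)

text \<open>The multiplication rule of the wreath product. Column \<open>j\<close> of the right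
  factor is nonzero only in row \<open>\<tau> j\<close>, so a single term of the sum
  survives.\<close>

lemma zero_mat_mult_monomial:
  assumes "\<tau> permutes {..<n}"
  shows "zero_mat_mult G n (monomial_mat n \<sigma> g) (monomial_mat n \<tau> h)
    = monomial_mat n (\<sigma> \<circ> \<tau>) (\<lambda>j. g (\<tau> j) \<otimes>\<^bsub>G\<^esub> h j)" (is "?L = ?R")
proof (rule eq_matI)
  fix i j
  assume "i < dim_row ?R" "j < dim_col ?R"
  then have ij: "i < n" "j < n"
    by (auto simp: monomial_mat_def)
  then have "\<tau> j < n"
    using permutes_in_image[OF assms, of j] by simp
  then have "?L $$ (i, j)
      = zero_mult G (monomial_mat n \<sigma> g $$ (i, \<tau> j)) (monomial_mat n \<tau> h $$ (\<tau> j, j))"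
    using ij by (intro zero_mat_mult_entry_single) (auto simp: monomial_mat_def)
  then show "?L $$ (i, j) = ?R $$ (i, j)"
    using ij \<open>\<tau> j < n\<close> by (simp add: monomial_mat_def)
qed (auto simp: monomial_mat_def zero_mat_mult_def)

lemma monomial_mat_in_Gwr:
  assumes \<sigma>: "\<sigma> permutes {..<n}" and g: "g \<in> {..<n} \<rightarrow> carrier G"
  shows "monomial_mat n \<sigma> g \<in> carrier (Gwr G n)"
proof -
  have "\<exists>!j. j < n \<and> monomial_mat n \<sigma> g $$ (i, j) \<noteq> None" if "i < n" for i
  proof (rule ex1I)
    \<comment> \<open>Row \<open>i\<close> has its entry in the column that \<sigma> sends to
      \<open>i\<close>.\<close>
    show "inv_into UNIV \<sigma> i < n \<and> monomial_mat n \<sigma> g $$ (i, inv_into UNIV \<sigma> i) \<noteq> None"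
      using that permutes_in_image[OF permutes_inv[OF \<sigma>], of i] permutes_inverses[OF \<sigma>]
      by (simp add: monomial_mat_def)
    show "j = inv_into UNIV \<sigma> i" if "j < n \<and> monomial_mat n \<sigma> g $$ (i, j) \<noteq> None" for j
      using that \<open>i < n\<close> permutes_inverses[OF \<sigma>] by (auto simp: monomial_mat_def split: if_splits)
  qed
  moreover have "\<exists>!i. i < n \<and> monomial_mat n \<sigma> g $$ (i, j) \<noteq> None" if "j < n" for j
    using that permutes_in_image[OF \<sigma>, of j]
    by (intro ex1I[of _ "\<sigma> j"]) (auto simp: monomial_mat_def split: if_splits)
  ultimately show ?thesis
    using g by (auto simp: Gwr_def monomial_mat_def)
qed

text \<open>The nonzero entry of each column defines \<sigma>. Uniqueness within rows makes \<sigma>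
  injective, hence a permutation of a finite set.\<close>

lemma Gwr_monomialE:
  assumes "A \<in> carrier (Gwr G n)"
  obtains \<sigma> g where "\<sigma> permutes {..<n}" "g \<in> {..<n} \<rightarrow> carrier G" "A = monomial_mat n \<sigma> g"
proof -
  have dim: "A \<in> carrier_mat n n"
    and ent: "\<And>i j. i < n \<Longrightarrow> j < n \<Longrightarrow> A $$ (i, j) \<in> insert None (Some ` carrier G)"
    and row: "\<And>i. i < n \<Longrightarrow> \<exists>!j. j < n \<and> A $$ (i, j) \<noteq> None"
    and col: "\<And>j. j < n \<Longrightarrow> \<exists>!i. i < n \<and> A $$ (i, j) \<noteq> None"
    using assms by (auto simp: Gwr_def)
  \<comment> \<open>The value \<open>j\<close> beyond the index range is what
    \<open>permutes\<close> demands.\<close>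
  define \<sigma> where "\<sigma> j = (if j < n then THE i. i < n \<and> A $$ (i, j) \<noteq> None else j)" for j
  define g where "g j = the (A $$ (\<sigma> j, j))" for j
  have \<sigma>: "\<sigma> j < n" "A $$ (\<sigma> j, j) \<noteq> None" if "j < n" for j
    using theI'[OF col[OF that]] that by (auto simp: \<sigma>_def)
  have \<sigma>_unique: "i = \<sigma> j" if "i < n" "j < n" "A $$ (i, j) \<noteq> None" for i j
    using that \<sigma> col by blast
  have "inj_on \<sigma> {..<n}"
    using \<sigma> row by (intro inj_onI) (metis lessThan_iff)
  moreover from this have "\<sigma> ` {..<n} = {..<n}"
    using \<sigma> by (intro endo_inj_surj) auto
  ultimately have "\<sigma> permutes {..<n}"
    by (intro bij_imp_permutes) (auto simp: bij_betw_def \<sigma>_def)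
  moreover have "g j \<in> carrier G" if "j < n" for j
    using that \<sigma>[OF that] ent[of "\<sigma> j" j] by (auto simp: g_def)
  then have "g \<in> {..<n} \<rightarrow> carrier G"
    by auto
  moreover have "A = monomial_mat n \<sigma> g"
  proof (rule eq_matI)
    fix i j
    assume "i < dim_row (monomial_mat n \<sigma> g)" "j < dim_col (monomial_mat n \<sigma> g)"
    then have ij: "i < n" "j < n"
      by (auto simp: monomial_mat_def)
    then show "A $$ (i, j) = monomial_mat n \<sigma> g $$ (i, j)"
      using \<sigma>[of j] \<sigma>_unique[of i j]
      by (cases "A $$ (i, j)") (auto simp: monomial_mat_def g_def)
  qed (use dim in \<open>auto simp: monomial_mat_def\<close>)
  ultimately show thesis
    by (rule that)
qed

section \<open>Singular and nonsingular elements\<close>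

lemma Gwr_subset_Gbar: "carrier (Gwr G n) \<subseteq> carrier (Gbar G n)"
  by (auto simp: Gwr_def Gbar_def Uniq_def)

lemma mult_Gbar [simp]: "A \<otimes>\<^bsub>Gbar G n\<^esub> B = zero_mat_mult G n A B"
  by (simp add: Gbar_def)

lemma mult_Gwr [simp]: "A \<otimes>\<^bsub>Gwr G n\<^esub> B = zero_mat_mult G n A B"
  by (simp add: Gwr_def)

lemma one_Gwr: "\<one>\<^bsub>Gwr G n\<^esub> = \<one>\<^bsub>Gbar G n\<^esub>"
  by (simp add: Gwr_def)

lemma one_Gbar: "\<one>\<^bsub>Gbar G n\<^esub> = group_tuple n (\<lambda>_. \<one>\<^bsub>G\<^esub>)"
  by (simp add: Gbar_def group_tuple_def)

text \<open>An injective self-map of \<open>{..<n}\<close> is surjective, so it suffices to test rows or columns.\<close>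

lemma Gwr_if_rows_nonzero:
  assumes A: "A \<in> carrier (Gbar G n)" and rows: "\<And>i. i < n \<Longrightarrow> \<exists>j<n. A $$ (i, j) \<noteq> None"
  shows "A \<in> carrier (Gwr G n)"
proof -
  from rows obtain f where f: "\<And>i. i < n \<Longrightarrow> f i < n \<and> A $$ (i, f i) \<noteq> None"
    by metis
  have rowu: "\<And>i j k. i < n \<Longrightarrow> j < n \<Longrightarrow> k < n \<Longrightarrow> A $$ (i, j) \<noteq> None \<Longrightarrow> A $$ (i, k) \<noteq> None \<Longrightarrow> j = k"
    and colu: "\<And>i j k. i < n \<Longrightarrow> j < n \<Longrightarrow> k < n \<Longrightarrow> A $$ (j, i) \<noteq> None \<Longrightarrow> A $$ (k, i) \<noteq> None \<Longrightarrow> j = k"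
    using A unfolding Gbar_def Uniq_def by simp_all
  \<comment> \<open>Two rows with the same chosen column would give that column two nonzero
    entries.\<close>
  have "inj_on f {..<n}"
    using f colu by (intro inj_onI) (metis lessThan_iff)
  then have "f ` {..<n} = {..<n}"
    using f by (intro endo_inj_surj) auto
  then have "\<exists>i<n. A $$ (i, j) \<noteq> None" if "j < n" for j
    using that f by (metis imageE lessThan_iff)
  then have "\<exists>!i. i < n \<and> A $$ (i, j) \<noteq> None" if "j < n" for j
    using that colu by blast
  moreover have "\<exists>!j. j < n \<and> A $$ (i, j) \<noteq> None" if "i < n" for i
    using that rows rowu by blast
  ultimately show ?thesis
    using A by (simp add: Gwr_def Gbar_def)
qed

text \<open>The dual choice of a nonzero row for each column is injective and so meets every row,
  which reduces the claim to the row criterion.\<close>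

lemma Gwr_if_cols_nonzero:
  assumes A: "A \<in> carrier (Gbar G n)" and cols: "\<And>j. j < n \<Longrightarrow> \<exists>i<n. A $$ (i, j) \<noteq> None"
  shows "A \<in> carrier (Gwr G n)"
proof (rule Gwr_if_rows_nonzero[OF A])
  from cols obtain f where f: "\<And>j. j < n \<Longrightarrow> f j < n \<and> A $$ (f j, j) \<noteq> None"
    by metis
  have rowu: "\<And>i j k. i < n \<Longrightarrow> j < n \<Longrightarrow> k < n \<Longrightarrow> A $$ (i, j) \<noteq> None \<Longrightarrow> A $$ (i, k) \<noteq> None \<Longrightarrow> j = k"
    using A unfolding Gbar_def Uniq_def by simp
  have "inj_on f {..<n}"
    using f rowu by (intro inj_onI) (metis lessThan_iff)
  then have "f ` {..<n} = {..<n}"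
    using f by (intro endo_inj_surj) auto
  then show "\<exists>j<n. A $$ (i, j) \<noteq> None" if "i < n" for i
    using that f by (metis imageE lessThan_iff)
qed

lemma Gwr_rows_nonzero:
  assumes "A \<in> carrier (Gwr G n)" "i < n"
  shows "\<exists>j<n. A $$ (i, j) \<noteq> None"
proof -
  have "\<exists>!j. j < n \<and> A $$ (i, j) \<noteq> None"
    using assms unfolding Gwr_def by simp
  then show ?thesis
    by blast
qed

lemma Gwr_cols_nonzero:
  assumes "A \<in> carrier (Gwr G n)" "j < n"
  shows "\<exists>i<n. A $$ (i, j) \<noteq> None"
proof -
  have "\<exists>!i. i < n \<and> A $$ (i, j) \<noteq> None"
    using assms unfolding Gwr_def by simp
  then show ?thesis
    by blast
qed

section \<open>The submonoid of nonsingular elements and the idempotents \<open>eps\<close>\<close>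

context group
begin

lemma one_Gwr_closed: "\<one>\<^bsub>Gwr G n\<^esub> \<in> carrier (Gwr G n)"
  unfolding one_Gwr one_Gbar group_tuple_eq_monomial
  by (rule monomial_mat_in_Gwr) (auto simp: permutes_id)

lemma Gwr_mult_closed:
  assumes "A \<in> carrier (Gwr G n)" "B \<in> carrier (Gwr G n)"
  shows "zero_mat_mult G n A B \<in> carrier (Gwr G n)"
proof -
  obtain \<sigma> g where \<sigma>: "\<sigma> permutes {..<n}" "g \<in> {..<n} \<rightarrow> carrier G" "A = monomial_mat n \<sigma> g"
    using assms(1) by (rule Gwr_monomialE)
  obtain \<tau> h where \<tau>: "\<tau> permutes {..<n}" "h \<in> {..<n} \<rightarrow> carrier G" "B = monomial_mat n \<tau> h"
    using assms(2) by (rule Gwr_monomialE)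
  have "\<tau> j < n" if "j < n" for j
    using that permutes_in_image[OF \<tau>(1), of j] by simp
  then have "(\<lambda>j. g (\<tau> j) \<otimes> h j) \<in> {..<n} \<rightarrow> carrier G"
    using \<sigma>(2) \<tau>(2) by auto
  then show ?thesis
    unfolding \<sigma>(3) \<tau>(3) zero_mat_mult_monomial[OF \<tau>(1)]
    using \<sigma>(1) \<tau>(1) by (intro monomial_mat_in_Gwr permutes_compose)
qed

text \<open>This supplies the hypothesis \<open>prime\<close> for \<Phi>. A nonzero row of the
  product forces the same row of \<open>A\<close> to be nonzero, and a nonzero column the same
  column of \<open>B\<close>; hence the row test for \<open>A\<close> and the column test for
  \<open>B\<close>.\<close>

lemma Gwr_mult_iff:
  assumes "A \<in> carrier (Gbar G n)" "B \<in> carrier (Gbar G n)"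
  shows "zero_mat_mult G n A B \<in> carrier (Gwr G n) \<longleftrightarrow>
    A \<in> carrier (Gwr G n) \<and> B \<in> carrier (Gwr G n)"
proof
  assume AB: "zero_mat_mult G n A B \<in> carrier (Gwr G n)"
  have "A \<in> carrier (Gwr G n)"
    using assms(1)
  proof (rule Gwr_if_rows_nonzero)
    show "\<exists>k<n. A $$ (i, k) \<noteq> None" if "i < n" for i
      using Gwr_rows_nonzero[OF AB that] zero_mat_mult_entry_None[OF that] by metis
  qed
  moreover have "B \<in> carrier (Gwr G n)"
    using assms(2)
  proof (rule Gwr_if_cols_nonzero)
    show "\<exists>k<n. B $$ (k, j) \<noteq> None" if "j < n" for j
      using Gwr_cols_nonzero[OF AB that] zero_mat_mult_entry_None[OF _ that] by metis
  qed
  ultimately show "A \<in> carrier (Gwr G n) \<and> B \<in> carrier (Gwr G n)" ..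
qed (simp add: Gwr_mult_closed)

lemma eps_in_Gbar: "eps G n j \<in> carrier (Gbar G n)"
  by (auto simp: eps_def diag_matrix_def Gbar_def Uniq_def split: if_splits)

lemma eps_notin_Gwr:
  assumes "j < n"
  shows "eps G n j \<notin> carrier (Gwr G n)"
proof
  assume "eps G n j \<in> carrier (Gwr G n)"
  from Gwr_rows_nonzero[OF this assms] show False
    using assms by (auto simp: eps_def diag_matrix_def split: if_splits)
qed

text \<open>Left multiplication by \<open>eps G n j\<close> erases row \<open>j\<close> and fixes
  the others, so nothing changes if that row is already zero.\<close>

lemma eps_mult_absorb:
  assumes A: "A \<in> carrier (Gbar G n)" and row: "\<And>k. k < n \<Longrightarrow> A $$ (j, k) = None"
  shows "zero_mat_mult G n (eps G n j) A = A" (is "?L = A")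
proof (rule eq_matI)
  have dim: "A \<in> carrier_mat n n"
    and ent: "\<And>i j. i < n \<Longrightarrow> j < n \<Longrightarrow> A $$ (i, j) \<in> insert None (Some ` carrier G)"
    using A by (auto simp: Gbar_def)
  show "dim_row ?L = dim_row A" "dim_col ?L = dim_col A"
    using dim by (auto simp: zero_mat_mult_def)
  fix i k
  assume "i < dim_row A" "k < dim_col A"
  then have ik: "i < n" "k < n"
    using dim by auto
  then have "?L $$ (i, k) = zero_mult G (eps G n j $$ (i, i)) (A $$ (i, k))"
    by (intro zero_mat_mult_entry_single) (auto simp: eps_def diag_matrix_def)
  then show "?L $$ (i, k) = A $$ (i, k)"
    using ik ent[OF ik] row by (auto simp: eps_def diag_matrix_def)
qed

end

section \<open>Generators of the wreath product\<close>

text \<open>Transpositions generate the symmetric group, and each is obtained from adjacent ones by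
  repeated conjugation.\<close>

lemma permutes_adjacent_induct [consumes 1, case_names id adjacent comp]:
  assumes \<sigma>: "\<sigma> permutes {..<n}"
    and id: "P id"
    and adj: "\<And>i. Suc i < n \<Longrightarrow> P (Transposition.transpose i (Suc i))"
    and comp: "\<And>\<sigma> \<tau>. \<sigma> permutes {..<n} \<Longrightarrow> \<tau> permutes {..<n} \<Longrightarrow> P \<sigma> \<Longrightarrow> P \<tau> \<Longrightarrow> P (\<sigma> \<circ> \<tau>)"
  shows "P \<sigma>"
proof -
  have swap_permutes: "Transposition.transpose a b permutes {..<n}" if "a < n" "b < n" for a b
    using that by (intro permutes_swap_id) auto
  have less: "P (Transposition.transpose a b)" if "a < b" "b < n" for a b
    using that
  proof (induction b)
    case (Suc b)
    show ?case
    proof (cases "a = b")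
      case True
      then show ?thesis
        using adj Suc.prems by simp
    next
      case False
      let ?t = "Transposition.transpose b (Suc b)"
      have "P (Transposition.transpose a b)" "P ?t"
        using False Suc adj by auto
      moreover have "?t permutes {..<n}" "Transposition.transpose a b permutes {..<n}"
        using Suc.prems by (auto intro: swap_permutes)
      ultimately have "P (?t \<circ> (Transposition.transpose a b \<circ> ?t))"
        by (intro comp permutes_compose)
      \<comment> \<open>Conjugating a transposition by \<open>?t\<close> relabels its point
        \<open>b\<close> as \<open>Suc b\<close>.\<close>
      also have "?t \<circ> (Transposition.transpose a b \<circ> ?t) = Transposition.transpose a (Suc b)"
        using False Suc.prems by (auto simp: fun_eq_iff Transposition.transpose_def)
      finally show ?thesis .
    qed
  qed simp
  have transp: "P (Transposition.transpose a b)" if "a < n" "b < n" for a b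
    using less[of a b] less[of b a] that id
    by (cases a b rule: linorder_cases) (auto simp: transpose_commute)
  from \<sigma> finite_lessThan show ?thesis
  proof (induction rule: permutes_induct)
    case (swap a b p)
    then show ?case
      by (intro comp swap_permutes transp) auto
  qed (rule id)
qed

text \<open>Every element is a permutation matrix times a group tuple, and the permutation matrix is
  reached through adjacent transpositions.\<close>

lemma (in group) Gwr_generator_induct [consumes 1, case_names tuple transp mult]:
  assumes A: "A \<in> carrier (Gwr G n)"
    and tuple: "\<And>g. g \<in> {..<n} \<rightarrow> carrier G \<Longrightarrow> P (group_tuple n g)"
    and transp: "\<And>i. Suc i < n \<Longrightarrow> P (simple_transp G n i)"
    and mult: "\<And>A B. A \<in> carrier (Gwr G n) \<Longrightarrow> B \<in> carrier (Gwr G n) \<Longrightarrow> P A \<Longrightarrow> P B \<Longrightarrow>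
      P (zero_mat_mult G n A B)"
  shows "P A"
proof -
  have perm: "perm_matrix G n \<sigma> \<in> carrier (Gwr G n)" if "\<sigma> permutes {..<n}" for \<sigma>
    unfolding perm_matrix_eq_monomial using that by (rule monomial_mat_in_Gwr) auto
  have P_perm: "P (perm_matrix G n \<sigma>)" if "\<sigma> permutes {..<n}" for \<sigma>
    using that
  proof (induction rule: permutes_adjacent_induct)
    case id
    show ?case
      \<comment> \<open>The identity matrix is covered by the tuple of ones.\<close>
      using tuple[of "\<lambda>_. \<one>"] by (simp add: perm_matrix_eq_monomial group_tuple_eq_monomial id_def)
  next
    case (adjacent i)
    then show ?case
      using transp by (simp add: simple_transp_def)
  next
    case (comp \<sigma> \<tau>)
    have "zero_mat_mult G n (perm_matrix G n \<sigma>) (perm_matrix G n \<tau>) = perm_matrix G n (\<sigma> \<circ> \<tau>)"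
      unfolding perm_matrix_eq_monomial zero_mat_mult_monomial[OF comp.hyps(2)] by simp
    moreover have "P (zero_mat_mult G n (perm_matrix G n \<sigma>) (perm_matrix G n \<tau>))"
      using perm[OF comp.hyps(1)] perm[OF comp.hyps(2)] comp.IH by (rule mult)
    ultimately show ?case
      by (simp only:)
  qed
  obtain \<sigma> g where \<sigma>: "\<sigma> permutes {..<n}" and g: "g \<in> {..<n} \<rightarrow> carrier G"
    and A_eq: "A = monomial_mat n \<sigma> g"
    using A by (rule Gwr_monomialE)
  \<comment> \<open>Proved on matrices, since \<open>g j\<close> is known to lie in the group only
    for \<open>j < n\<close>.\<close>
  have "monomial_mat n \<sigma> (\<lambda>j. \<one> \<otimes> g j) = monomial_mat n \<sigma> g"
    using g by (auto simp: monomial_mat_def Pi_iff intro!: eq_matI)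
  then have "A = zero_mat_mult G n (perm_matrix G n \<sigma>) (group_tuple n g)"
    unfolding A_eq perm_matrix_eq_monomial group_tuple_eq_monomial
    by (simp add: zero_mat_mult_monomial permutes_id)
  moreover have "group_tuple n g \<in> carrier (Gwr G n)"
    unfolding group_tuple_eq_monomial using permutes_id g by (rule monomial_mat_in_Gwr)
  then have "P (zero_mat_mult G n (perm_matrix G n \<sigma>) (group_tuple n g))"
    using perm[OF \<sigma>] P_perm[OF \<sigma>] tuple[OF g] by (intro mult)
  ultimately show ?thesis
    by (simp only:)
qed

section \<open>The homomorphism\<close>

text \<open>The generators already force all values on the basis; \<Phi> and any competitor are
  later compared through this one formula.\<close>

lemma generator_assignment_basis:
  fixes F :: "('f, 'x) ring_scheme" and G :: "('g, 'm) monoid_scheme"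
  assumes "field F" "group G"
    and \<Psi>: "\<Psi> \<in> algebra_hom F (monoid_algebra F (Gbar G n)) (monoid_algebra F (Gwr G n))"
    and gen: "generator_assignment F G n \<Psi>"
    and A: "A \<in> carrier (Gbar G n)"
  shows "\<Psi> (basis_elem F A) =
    (if A \<in> carrier (Gwr G n) then basis_elem F A else \<zero>\<^bsub>monoid_algebra F (Gwr G n)\<^esub>)"
proof -
  interpret F: field F by fact
  interpret G: group G by fact
  let ?B = "monoid_algebra F (Gwr G n)"
  have \<Psi>_mult: "\<Psi> (basis_elem F (zero_mat_mult G n A B))
      = \<Psi> (basis_elem F A) \<otimes>\<^bsub>?B\<^esub> \<Psi> (basis_elem F B)"
    if "A \<in> carrier (Gbar G n)" "B \<in> carrier (Gbar G n)" for A B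
  proof -
    have "basis_elem F (zero_mat_mult G n A B)
        = basis_elem F A \<otimes>\<^bsub>monoid_algebra F (Gbar G n)\<^esub> basis_elem F B"
      by (simp add: F.basis_elem_mult)
    moreover have "\<Psi> \<in> ring_hom (monoid_algebra F (Gbar G n)) ?B"
      using \<Psi> by (simp add: algebra_hom_def)
    ultimately show ?thesis
      using that by (simp add: ring_hom_mult[of _ _ ?B] F.basis_elem_in_carrier)
  qed
  have nonsing: "\<Psi> (basis_elem F A) = basis_elem F A" if "A \<in> carrier (Gwr G n)"
    using that
  proof (induction rule: G.Gwr_generator_induct)
    \<comment> \<open>Both factors are fixed by \<Psi>, and their product in the smaller algebra is
      again the basis element of the matrix product.\<close>
    case (mult A B)
    then show ?case
      using \<Psi>_mult[of A B] Gwr_subset_Gbar[of G n] F.basis_elem_mult[where s = A and t = B and S = "Gwr G n"]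
      by (simp add: subset_iff)
  qed (use gen in \<open>auto simp: generator_assignment_def\<close>)
  have eps: "\<Psi> (basis_elem F (eps G n j)) = \<zero>\<^bsub>?B\<^esub>" if "j < n" for j
    using gen that by (simp add: generator_assignment_def)
  have sing: "\<Psi> (basis_elem F A) = \<zero>\<^bsub>?B\<^esub>" if "A \<notin> carrier (Gwr G n)"
  proof -
    have "\<not> (\<forall>i<n. \<exists>k<n. A $$ (i, k) \<noteq> None)"
      using that Gwr_if_rows_nonzero[OF A] by blast
    then obtain j where j: "j < n" and row: "\<forall>k<n. A $$ (j, k) = None"
      by blast
    \<comment> \<open>Row \<open>j\<close> of \<open>A\<close> is zero, so \<open>A\<close> absorbs
      \<open>eps G n j\<close> on the left, and the first factor here is zero.\<close>
    then have "\<Psi> (basis_elem F A) = \<Psi> (basis_elem F (eps G n j)) \<otimes>\<^bsub>?B\<^esub> \<Psi> (basis_elem F A)"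
      using \<Psi>_mult[OF G.eps_in_Gbar A, of j] by (simp add: G.eps_mult_absorb[OF A])
    then show ?thesis
      by (simp add: eps[OF j] F.monoid_algebra_zero_mult)
  qed
  show ?thesis
    using nonsing sing by simp
qed

text \<open>That the assignment defines \<Phi> is read as existence together with uniqueness.
  Uniqueness is asserted on the carrier, as HOL functions also take values outside it.\<close>

theorem corollary2p5:
  fixes F :: "('f, 'x) ring_scheme" and G :: "('g, 'm) monoid_scheme" and n :: nat
  assumes "field F" and "group G" and "finite (carrier G)" and "n \<ge> 1"
  shows "\<exists>\<Phi> \<in> algebra_hom F (monoid_algebra F (Gbar G n)) (monoid_algebra F (Gwr G n)).
      generator_assignment F G n \<Phi> \<and>
      (\<forall>x \<in> carrier (monoid_algebra F (Gwr G n)). \<Phi> x = x) \<and>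
      (\<forall>\<Psi> \<in> algebra_hom F (monoid_algebra F (Gbar G n)) (monoid_algebra F (Gwr G n)).
         generator_assignment F G n \<Psi> \<longrightarrow>
         (\<forall>x \<in> carrier (monoid_algebra F (Gbar G n)). \<Psi> x = \<Phi> x))"
proof -
  interpret F: field F by fact
  interpret G: group G by fact
  let ?A = "monoid_algebra F (Gbar G n)" and ?B = "monoid_algebra F (Gwr G n)"
  let ?\<Phi> = "F.restrict_coeffs (carrier (Gwr G n))"
  have hom: "?\<Phi> \<in> algebra_hom F ?A ?B"
    by (rule F.restrict_coeffs_algebra_hom)
      (simp_all add: one_Gwr G.one_Gwr_closed[unfolded one_Gwr] G.Gwr_mult_iff)
  have "group_tuple n g \<in> carrier (Gwr G n)" if "g \<in> {..<n} \<rightarrow> carrier G" for g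
    unfolding group_tuple_eq_monomial using permutes_id that by (rule monomial_mat_in_Gwr)
  moreover have "simple_transp G n i \<in> carrier (Gwr G n)" if "Suc i < n" for i
    unfolding simple_transp_def perm_matrix_eq_monomial
    using that by (intro monomial_mat_in_Gwr permutes_swap_id) auto
  \<comment> \<open>This identifies the target's zero with the value of the projection at each
    singular basis element, in particular at each \<open>eps G n j\<close>.\<close>
  moreover have "\<zero>\<^bsub>?B\<^esub> = (\<lambda>_. \<zero>\<^bsub>F\<^esub>)"
    by (simp add: monoid_algebra_def)
  ultimately have gen: "generator_assignment F G n ?\<Phi>"
    by (auto simp: generator_assignment_def F.restrict_coeffs_basis_elem G.eps_notin_Gwr)
  have "\<Psi> x = ?\<Phi> x"
    if "\<Psi> \<in> algebra_hom F ?A ?B" "generator_assignment F G n \<Psi>" "x \<in> carrier ?A" for \<Psi> x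
    using that(1) hom _ that(3)
  proof (rule F.algebra_hom_eqI)
    fix s
    assume "s \<in> carrier (Gbar G n)"
    then show "\<Psi> (basis_elem F s) = ?\<Phi> (basis_elem F s)"
      \<comment> \<open>The restriction is itself an admissible homomorphism, so the same formula
        evaluates both sides.\<close>
      by (simp add: generator_assignment_basis[OF assms(1,2) that(1,2)]
          generator_assignment_basis[OF assms(1,2) hom gen])
  qed
  with hom gen show ?thesis
    using F.restrict_coeffs_id[of _ "Gwr G n"] by blast
qed

end
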